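(* For every $n\ge1$, each irreducible representation of the Chinese monoid $C_n$ over $K$ is monomial.
   Context: $K$ is a nondenumerable (uncountable) algebraically closed field. For a positive integer $n$, the Chinese monoid of rank $n$ is the monoid $C_n=\langle a_1,\dots,a_n\rangle$ given by the defining relations $a_ja_ka_i=a_ka_ja_i=a_ka_ia_j$ for all $i\le j\le k$. Irreducible representations of $C_n$ in a $K$-linear space $V$ correspond to simple left modules $V$ over the monoid algebra $K[C_n]$. A representation of a monoid $M$ in a $K$-linear space $V$ is monomial if $V$ admits a basis $E$ such that for each $w\in M$ and each $e\in E$ there exist $\lambda\in K$ and $f\in E$ with $we=\lambda f$. *)

theory Defs
  imports "HOL-Algebra.Group" "HOL-Computational_Algebra.Polynomial" "HOL-Library.Countable_Set"
begin

section \<open>Monoids given by generators and relations\<close>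

text \<open>The smallest congruence on the free monoid of words over \<open>A\<close> that contains all pairs in \<open>R\<close>.\<close>

inductive_set presentation_cong :: "'a set \<Rightarrow> ('a list \<times> 'a list) set \<Rightarrow> ('a list \<times> 'a list) set"
  for A :: "'a set" and R :: "('a list \<times> 'a list) set"
  where
    rel: "(u, v) \<in> R \<Longrightarrow> u \<in> lists A \<Longrightarrow> v \<in> lists A \<Longrightarrow> (u, v) \<in> presentation_cong A R"
  | refl: "u \<in> lists A \<Longrightarrow> (u, u) \<in> presentation_cong A R"
  | sym: "(u, v) \<in> presentation_cong A R \<Longrightarrow> (v, u) \<in> presentation_cong A R"
  | trans: "(u, v) \<in> presentation_cong A R \<Longrightarrow> (v, w) \<in> presentation_cong A R
      \<Longrightarrow> (u, w) \<in> presentation_cong A R"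
  | append: "(u, v) \<in> presentation_cong A R \<Longrightarrow> (u', v') \<in> presentation_cong A R
      \<Longrightarrow> (u @ u', v @ v') \<in> presentation_cong A R"

definition presented_monoid :: "'a set \<Rightarrow> ('a list \<times> 'a list) set \<Rightarrow> 'a list set monoid"
  where "presented_monoid A R =
    \<lparr>carrier = lists A // presentation_cong A R,
     monoid.mult = (\<lambda>X Y. \<Union>u\<in>X. \<Union>v\<in>Y. presentation_cong A R `` {u @ v}),
     one = presentation_cong A R `` {[]}\<rparr>"

lemma presentation_cong_in_lists:
  assumes "(u, v) \<in> presentation_cong A R"
  shows "u \<in> lists A \<and> v \<in> lists A"
  using assms by induction auto

lemma equiv_presentation_cong: "equiv (lists A) (presentation_cong A R)"
proof (rule equivI)
  show "presentation_cong A R \<subseteq> lists A \<times> lists A"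
    using presentation_cong_in_lists by fast
  show "refl_on (lists A) (presentation_cong A R)"
    by (auto intro!: refl_onI presentation_cong.refl)
  show "Relation.sym (presentation_cong A R)"
    by (rule symI) (rule presentation_cong.sym)
  show "Relation.trans (presentation_cong A R)"
    by (rule transI) (rule presentation_cong.trans)
qed

lemma presented_monoid_mult_class:
  assumes "u \<in> lists A" "v \<in> lists A"
  shows "presentation_cong A R `` {u} \<otimes>\<^bsub>presented_monoid A R\<^esub> presentation_cong A R `` {v}
    = presentation_cong A R `` {u @ v}"
proof -
  have eq: "presentation_cong A R `` {x @ y} = presentation_cong A R `` {u @ v}"
    if "x \<in> presentation_cong A R `` {u}" "y \<in> presentation_cong A R `` {v}" for x y
    using that
    by (intro equiv_class_eq[OF equiv_presentation_cong, symmetric] presentation_cong.append) auto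
  have "u \<in> presentation_cong A R `` {u}" "v \<in> presentation_cong A R `` {v}"
    using assms by (auto intro: presentation_cong.refl)
  then have "(\<Union>x\<in>presentation_cong A R `` {u}. \<Union>y\<in>presentation_cong A R `` {v}.
      presentation_cong A R `` {x @ y}) = presentation_cong A R `` {u @ v}"
    using eq by blast
  then show ?thesis
    by (simp add: presented_monoid_def)
qed

lemma monoid_presented_monoid: "monoid (presented_monoid A R)"
proof -
  have car: "\<exists>u\<in>lists A. X = presentation_cong A R `` {u}" if "X \<in> carrier (presented_monoid A R)" for X
    using that by (auto simp: presented_monoid_def elim!: quotientE)
  have cls: "presentation_cong A R `` {u} \<in> carrier (presented_monoid A R)" if "u \<in> lists A" for u
    using that by (auto simp: presented_monoid_def intro: quotientI)
  have one: "\<one>\<^bsub>presented_monoid A R\<^esub> = presentation_cong A R `` {[]}"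
    by (simp add: presented_monoid_def)
  show ?thesis
  proof (rule monoidI)
    fix x y assume "x \<in> carrier (presented_monoid A R)" "y \<in> carrier (presented_monoid A R)"
    then obtain u v where "u \<in> lists A" "v \<in> lists A"
      "x = presentation_cong A R `` {u}" "y = presentation_cong A R `` {v}"
      using car by metis
    then show "x \<otimes>\<^bsub>presented_monoid A R\<^esub> y \<in> carrier (presented_monoid A R)"
      using cls[of "u @ v"] by (simp add: presented_monoid_mult_class)
  next
    show "\<one>\<^bsub>presented_monoid A R\<^esub> \<in> carrier (presented_monoid A R)"
      using cls[of "[]"] by (simp add: one)
  next
    fix x y z assume "x \<in> carrier (presented_monoid A R)" "y \<in> carrier (presented_monoid A R)"
      "z \<in> carrier (presented_monoid A R)"
    then obtain u v w where "u \<in> lists A" "v \<in> lists A" "w \<in> lists A"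
      "x = presentation_cong A R `` {u}" "y = presentation_cong A R `` {v}"
      "z = presentation_cong A R `` {w}"
      using car by metis
    then show "x \<otimes>\<^bsub>presented_monoid A R\<^esub> y \<otimes>\<^bsub>presented_monoid A R\<^esub> z
      = x \<otimes>\<^bsub>presented_monoid A R\<^esub> (y \<otimes>\<^bsub>presented_monoid A R\<^esub> z)"
      by (simp add: presented_monoid_mult_class)
  next
    fix x assume "x \<in> carrier (presented_monoid A R)"
    then obtain u where "u \<in> lists A" "x = presentation_cong A R `` {u}"
      using car by metis
    then show "\<one>\<^bsub>presented_monoid A R\<^esub> \<otimes>\<^bsub>presented_monoid A R\<^esub> x = x"
      "x \<otimes>\<^bsub>presented_monoid A R\<^esub> \<one>\<^bsub>presented_monoid A R\<^esub> = x"
      using presented_monoid_mult_class[of "[]" A u R] presented_monoid_mult_class[of u A "[]" R]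
      by (simp_all add: one)
  qed
qed

section \<open>The Chinese monoid\<close>

text \<open>The letter \<open>i \<in> {1..n}\<close> stands for the generator \<open>a\<^sub>i\<close>.\<close>

definition chinese_relations :: "nat \<Rightarrow> (nat list \<times> nat list) set"
  where "chinese_relations n =
    {([j, k, i], [k, j, i]) | i j k. 1 \<le> i \<and> i \<le> j \<and> j \<le> k \<and> k \<le> n} \<union>
    {([k, j, i], [k, i, j]) | i j k. 1 \<le> i \<and> i \<le> j \<and> j \<le> k \<and> k \<le> n}"

definition chinese_monoid :: "nat \<Rightarrow> nat list set monoid"
  where "chinese_monoid n = presented_monoid {1..n} (chinese_relations n)"

lemma monoid_chinese_monoid: "monoid (chinese_monoid n)"
  unfolding chinese_monoid_def by (rule monoid_presented_monoid)

section \<open>Linear representations of monoids\<close>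

text \<open>The space is the whole type \<open>'v\<close> with scalar multiplication \<open>scale\<close>;
  its dimension is not restricted.\<close>

locale monoid_representation = monoid M + vector_space scale
  for M :: "('m, 'x) monoid_scheme" (structure)
    and scale :: "'k::field \<Rightarrow> 'v::ab_group_add \<Rightarrow> 'v"
    and \<rho> :: "'m \<Rightarrow> 'v \<Rightarrow> 'v" +
  assumes rep_linear: "w \<in> carrier M \<Longrightarrow> Vector_Spaces.linear scale scale (\<rho> w)"
    and rep_one: "\<rho> \<one> = id"
    and rep_mult: "w \<in> carrier M \<Longrightarrow> z \<in> carrier M \<Longrightarrow> \<rho> (w \<otimes> z) = \<rho> w \<circ> \<rho> z"
begin

definition invariant_subspace :: "'v set \<Rightarrow> bool"
  where "invariant_subspace W \<longleftrightarrow> subspace W \<and> (\<forall>w\<in>carrier M. \<rho> w ` W \<subseteq> W)"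

definition irreducible_rep :: bool
  where "irreducible_rep \<longleftrightarrow>
    (UNIV :: 'v set) \<noteq> {0} \<and> (\<forall>W. invariant_subspace W \<longrightarrow> W = {0} \<or> W = UNIV)"

definition monomial_rep :: bool
  where "monomial_rep \<longleftrightarrow>
    (\<exists>E. independent E \<and> span E = UNIV \<and>
      (\<forall>w\<in>carrier M. \<forall>e\<in>E. \<exists>c. \<exists>f\<in>E. \<rho> w e = scale c f))"

end

end

theory Submission
  imports Defs
begin

text \<open>Write \<open>a\<^sub>i\<close> for the operator of the \<open>i\<close>-th generator. The relations say that \<open>a\<^sub>k a\<^sub>i\<close> commutes with
\<open>a\<^sub>j\<close> whenever \<open>i \<le> j \<le> k\<close>, and that \<open>a\<^sub>k\<close> kills the commutator of \<open>a\<^sub>i\<close> and \<open>a\<^sub>j\<close>. The proof is an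
induction on the number of generators, for operators indexed by any finite set of numbers that
satisfy the relations on a subspace \<open>V\<close> and act irreducibly there. A generator that
acts as a scalar can be dropped. Otherwise two neighbouring generators \<open>a\<^sub>s\<close>, \<open>a\<^sub>k\<close> act, up to a scalar factor, like the two
generators of the bicyclic monoid, \<open>V\<close> is a tensor product of the standard
representation of that monoid with a smaller space, and the remaining generators act on the smaller
space, up to a factor \<open>a\<^sub>s\<close> or \<open>a\<^sub>k\<close>, by the relations of a Chinese monoid with two generators less.

The pair is found as follows. Let \<open>N(t)\<close> be the common kernel of all \<open>a\<^sub>j\<close> with \<open>j \<ge> t\<close>, and choose
\<open>s\<close> with \<open>N(s) = 0\<close> but \<open>N = N(s + 1) \<noteq> 0\<close>. (If already \<open>N(0) \<noteq> 0\<close>, then all generators act as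
\<open>0\<close>.) Call an index lower if it is at most \<open>s\<close>, and upper otherwise. Since the \<open>a\<^sub>j\<close> with
\<open>j \<ge> s\<close> kill commutators of lower generators, the lower generators commute. For a lower \<open>i\<close> and an upper
\<open>j\<close> the product \<open>a\<^sub>j a\<^sub>i\<close> maps \<open>N\<close> to \<open>N\<close>, and every nonzero subspace of \<open>N\<close> that is invariant under
these pairs generates \<open>V\<close> under the lower generators alone (\<open>lower_span_eq_V\<close>). Let \<open>R\<close> be the set
of those \<open>v \<in> N\<close> with \<open>a\<^sub>j a\<^sub>s v = 0\<close> for all upper \<open>j\<close>.

\<^item> If \<open>R \<noteq> 0\<close>, then \<open>a\<^sub>s\<close> commutes with all generators (\<open>s_scalar_if_R_nonzero\<close>), so it is a scalar
  by Dixmier's form of Schur's lemma (\<open>schur_dixmier\<close>); this is where the field has to be uncountable and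
  algebraically closed.

\<^item> If \<open>R = 0\<close>, then \<open>N\<close> is irreducible under the pairs (\<open>N_irreducible\<close>). Let \<open>k\<close> be the least upper
  index. The pair \<open>a\<^sub>k a\<^sub>s\<close> commutes with all pairs on \<open>N\<close>, so it is a scalar \<open>\<mu>\<close> there.
  If \<open>\<mu> = 0\<close>, then \<open>a\<^sub>k = 0\<close> on \<open>V\<close>. If \<open>\<mu> \<noteq> 0\<close>, then \<open>\<mu> a\<^sub>i v = a\<^sub>s a\<^sub>k a\<^sub>i v\<close> for \<open>v \<in> N\<close> and lower \<open>i\<close>
  (\<open>lower_through_s\<close>). So \<open>V\<close> is the direct sum of the spaces \<open>a\<^sub>s\<^sup>r N\<close>. The operators \<open>a\<^sub>k a\<^sub>i\<close> for
  \<open>i < s\<close> and \<open>a\<^sub>j a\<^sub>s\<close> for \<open>j > k\<close> satisfy the Chinese relations on \<open>N\<close> (\<open>chinese_reduced\<close>), and if \<open>E'\<close>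
  is a monomial basis of \<open>N\<close> for them, then the vectors \<open>a\<^sub>s\<^sup>r e\<close> with \<open>e \<in> E'\<close> form a monomial basis
  of \<open>V\<close> (\<open>monomial_from_reduced\<close>).\<close>

section \<open>Countability and independence in vector spaces\<close>

text \<open>Definitions made in the locale \<open>vector_space\<close> itself would also be issued for its global
  interpretation by real vector spaces and clash there; a copy of the locale has no such
  interpretation.\<close>

locale operator_space = vector_space scale
  for scale :: "'k::field \<Rightarrow> 'v::ab_group_add \<Rightarrow> 'v"
begin

abbreviation endo :: "('v \<Rightarrow> 'v) \<Rightarrow> bool"
  where "endo \<equiv> Vector_Spaces.linear scale scale"

lemma endo_add: "endo f \<Longrightarrow> f (x + y) = f x + f y"
  by (simp add: Vector_Spaces.linear_iff)

lemma endo_scale: "endo f \<Longrightarrow> f (scale c x) = scale c (f x)"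
  by (simp add: Vector_Spaces.linear_iff)

lemma endo_zero: "endo f \<Longrightarrow> f 0 = 0"
  using endo_scale[of f 0 0] by simp

lemma endo_diff: "endo f \<Longrightarrow> f (x - y) = f x - f y"
  using endo_add[of f "x - y" y] by (simp add: algebra_simps)

lemma endo_sum: "endo f \<Longrightarrow> f (sum g A) = (\<Sum>x\<in>A. f (g x))"
  by (induction A rule: infinite_finite_induct) (simp_all add: endo_zero endo_add)

lemma endoI:
  "(\<And>x y. f (x + y) = f x + f y) \<Longrightarrow> (\<And>c x. f (scale c x) = scale c (f x)) \<Longrightarrow> endo f"
  by (simp add: Vector_Spaces.linear_iff vector_space_axioms)

lemma endo_comp: "endo f \<Longrightarrow> endo g \<Longrightarrow> endo (f \<circ> g)"
  by (rule endoI) (simp_all add: endo_add endo_scale)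

lemma endo_funpow: "endo f \<Longrightarrow> endo (f ^^ r)"
  by (induction r) (simp_all add: linear_id endo_comp flip: id_def)

text \<open>Each element of an independent set lies in the span of a finite part of the countable
  spanning set; there are countably many such parts, and each span contains finitely many
  elements of the independent set.\<close>

lemma countable_independent_in_countable_span:
  assumes W: "countable W" and B: "independent B" "B \<subseteq> span W"
  shows "countable B"
proof -
  have "B \<subseteq> (\<Union>F\<in>{F. F \<subseteq> W \<and> finite F}. B \<inter> span F)"
  proof
    fix b assume b: "b \<in> B"
    then obtain t r where "finite t" "t \<subseteq> W" "b = (\<Sum>a\<in>t. scale (r a) a)"
      using B(2) by (auto simp: span_explicit)
    then have "b \<in> span t"
      by (auto intro: span_sum span_scale span_base)
    then show "b \<in> (\<Union>F\<in>{F. F \<subseteq> W \<and> finite F}. B \<inter> span F)"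
      using b \<open>finite t\<close> \<open>t \<subseteq> W\<close> by blast
  qed
  moreover have "finite (B \<inter> span F)" if "finite F" for F
    using independent_span_bound[OF that, of "B \<inter> span F"] B(1) independent_mono[of B "B \<inter> span F"]
    by auto
  then have "countable (\<Union>F\<in>{F. F \<subseteq> W \<and> finite F}. B \<inter> span F)"
    using countable_Collect_finite_subset[OF W]
    by (intro countable_UN) (auto intro: countable_finite simp: conj_commute)
  ultimately show ?thesis
    using countable_subset by blast
qed

text \<open>Applying \<open>p\<close> to a linear relation removes the vectors of \<open>A\<close> and leaves a relation in \<open>B\<close>.\<close>

lemma independent_Un_kernel_section:
  assumes p: "endo p" and A: "independent A" "\<And>x. x \<in> A \<Longrightarrow> p x = 0"
    and B: "independent B" "\<And>x. x \<in> B \<Longrightarrow> p (f x) = x"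
  shows "independent (A \<union> f ` B)"
  unfolding independent_explicit_module
proof (intro allI impI)
  fix t u v
  assume t: "finite t" "t \<subseteq> A \<union> f ` B" and s: "(\<Sum>v\<in>t. scale (u v) v) = 0" and v: "v \<in> t"
  define c where "c = t \<inter> f ` B"
  have inj: "inj_on p c"
    using B(2) by (intro inj_onI) (auto simp: c_def)
  have "(\<Sum>x\<in>c. scale (u x) (p x)) = (\<Sum>x\<in>t. scale (u x) (p x))"
    using t A(2) by (intro sum.mono_neutral_left) (auto simp: c_def)
  also have "\<dots> = p (\<Sum>x\<in>t. scale (u x) x)"
    using p by (simp add: endo_sum endo_scale)
  finally have "(\<Sum>x\<in>c. scale (u x) (p x)) = 0"
    using s p by (simp add: endo_zero)
  moreover have ufp: "u (f (p x)) = u x" if "x \<in> c" for x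
    using that B(2) by (auto simp: c_def)
  ultimately have "(\<Sum>y\<in>p ` c. scale (u (f y)) y) = 0"
    using inj ufp by (simp add: sum.reindex cong: sum.cong_simp)
  moreover have "finite (p ` c)" "p ` c \<subseteq> B"
    using t B(2) by (auto simp: c_def)
  ultimately have "\<forall>y\<in>p ` c. u (f y) = 0"
    using independentD[OF B(1), of "p ` c" "\<lambda>y. u (f y)"] by blast
  then have uc: "u x = 0" if "x \<in> c" for x
    using that ufp by force
  have "(\<Sum>x\<in>t - c. scale (u x) x) = (\<Sum>x\<in>t. scale (u x) x)"
    using t uc by (intro sum.mono_neutral_left) auto
  then have "(\<Sum>x\<in>t - c. scale (u x) x) = 0" "finite (t - c)" "t - c \<subseteq> A"
    using s t by (auto simp: c_def)
  then have "\<forall>x\<in>t - c. u x = 0"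
    using independentD[OF A(1), of "t - c" u] by blast
  then show "u v = 0"
    using uc v by blast
qed

text \<open>The standard representation of the bicyclic monoid: \<open>f\<close> is the upward shift, \<open>p\<close> its left inverse,
  and \<open>E\<close> lies in the kernel of \<open>p\<close>. Each new layer of shifts is added by
  \<open>independent_Un_kernel_section\<close>.\<close>

lemma independent_shifts:
  assumes p: "endo p" and E: "independent E" "\<And>e. e \<in> E \<Longrightarrow> p e = 0"
    and f: "\<And>e r. e \<in> E \<Longrightarrow> p (f ((f ^^ r) e)) = (f ^^ r) e"
  shows "independent (\<Union>r. (f ^^ r) ` E)"
proof -
  have indep: "independent (\<Union>r<m. (f ^^ r) ` E)" for m
  proof (induction m)
    case (Suc m)
    have "(\<Union>r<Suc m. (f ^^ r) ` E) = E \<union> f ` (\<Union>r<m. (f ^^ r) ` E)"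
      unfolding lessThan_Suc_eq_insert_0 by (auto simp: image_UN image_image)
    then show ?case
      using independent_Un_kernel_section[OF p E Suc, of f] f by auto
  qed (simp add: dependent_def)
  have mono: "(\<Union>r<m. (f ^^ r) ` E) \<subseteq> (\<Union>r<m'. (f ^^ r) ` E)" if "m \<le> m'" for m m'
    using that by (intro UN_mono) auto
  have "independent (\<Union>(range (\<lambda>m. \<Union>r<m. (f ^^ r) ` E)))"
  proof (rule independent_Union_directed)
    fix c d
    assume "c \<in> range (\<lambda>m. \<Union>r<m. (f ^^ r) ` E)" "d \<in> range (\<lambda>m. \<Union>r<m. (f ^^ r) ` E)"
    then obtain m m' where "c = (\<Union>r<m. (f ^^ r) ` E)" "d = (\<Union>r<m'. (f ^^ r) ` E)"
      by blast
    then show "c \<subseteq> d \<or> d \<subseteq> c"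
      using mono[of m m'] mono[of m' m] by (meson nat_le_linear)
  qed (use indep in blast)
  moreover have "(\<Union>(range (\<lambda>m. \<Union>r<m. (f ^^ r) ` E))) = (\<Union>r. (f ^^ r) ` E)"
    by blast
  ultimately show ?thesis
    by simp
qed

section \<open>Polynomials in an operator\<close>

text \<open>The vector \<open>p(T) v\<close>, by Horner's scheme.\<close>

definition poly_act :: "('v \<Rightarrow> 'v) \<Rightarrow> 'k poly \<Rightarrow> 'v \<Rightarrow> 'v"
  where "poly_act T p v = fold_coeffs (\<lambda>a w. scale a v + T w) p 0"

lemma poly_act_0 [simp]: "poly_act T 0 v = 0"
  by (simp add: poly_act_def)

lemma poly_act_pCons: "endo T \<Longrightarrow> poly_act T (pCons a p) v = scale a v + T (poly_act T p v)"
  by (cases "a = 0 \<and> p = 0") (auto simp: poly_act_def endo_zero)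

lemma poly_act_add: "endo T \<Longrightarrow> poly_act T (p + q) v = poly_act T p v + poly_act T q v"
  by (induction p q rule: poly_induct2) (simp_all add: poly_act_pCons endo_add algebra_simps)

lemma poly_act_smult: "endo T \<Longrightarrow> poly_act T (smult c p) v = scale c (poly_act T p v)"
  by (induction p) (simp_all add: poly_act_pCons endo_scale algebra_simps)

lemma poly_act_sum: "endo T \<Longrightarrow> poly_act T (sum f A) v = (\<Sum>x\<in>A. poly_act T (f x) v)"
  by (induction A rule: infinite_finite_induct) (simp_all add: poly_act_add)

lemma endo_poly_act: "endo T \<Longrightarrow> endo (poly_act T p)"
  by (rule endoI; induction p)
    (simp_all add: poly_act_pCons endo_scale endo_add algebra_simps)

lemma poly_act_in_subspace:
  "endo T \<Longrightarrow> subspace V \<Longrightarrow> T ` V \<subseteq> V \<Longrightarrow> v \<in> V \<Longrightarrow> poly_act T p v \<in> V"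
  by (induction p) (auto simp: poly_act_pCons subspace_0 intro!: subspace_add subspace_scale)

lemma poly_act_commute: "endo T \<Longrightarrow> T (poly_act T p v) = poly_act T p (T v)"
  by (induction p) (simp_all add: poly_act_pCons endo_add endo_scale endo_zero)

lemma poly_act_linear_factor_outer:
  assumes "endo T"
  shows "poly_act T ([:- c, 1:] * p) v = T (poly_act T p v) - scale c (poly_act T p v)"
proof -
  have "[:- c, 1:] * p = smult (- c) p + pCons 0 p" by simp
  then show ?thesis
    using assms by (simp only: poly_act_pCons poly_act_add poly_act_smult) simp
qed

lemma poly_act_linear_factor_inner:
  assumes "endo T"
  shows "poly_act T ([:- c, 1:] * p) v = poly_act T p (T v - scale c v)"
  unfolding poly_act_linear_factor_outer[OF assms]
  using endo_poly_act[OF assms, of p] assms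
  by (simp add: poly_act_commute endo_diff endo_scale)

section \<open>Irreducible families of operators\<close>

text \<open>The operators live on the whole type but are only studied on an invariant subspace \<open>V\<close>: the induction
  passes to smaller and smaller subspaces, and these are not types.\<close>

definition irreducible_on :: "('v \<Rightarrow> 'v) set \<Rightarrow> 'v set \<Rightarrow> bool"
  where "irreducible_on F V \<longleftrightarrow>
    subspace V \<and> V \<noteq> {0} \<and> (\<forall>f\<in>F. endo f \<and> f ` V \<subseteq> V) \<and>
    (\<forall>W. subspace W \<and> W \<subseteq> V \<and> (\<forall>f\<in>F. f ` W \<subseteq> W) \<longrightarrow> W = {0} \<or> W = V)"

lemma irreducible_onD:
  assumes "irreducible_on F V" "subspace W" "W \<subseteq> V" "\<And>f w. f \<in> F \<Longrightarrow> w \<in> W \<Longrightarrow> f w \<in> W"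
    "w \<in> W" "w \<noteq> 0"
  shows "W = V"
  using assms unfolding irreducible_on_def by blast

lemma irreducible_on_cases:
  "irreducible_on F V \<Longrightarrow> subspace W \<Longrightarrow> W \<subseteq> V \<Longrightarrow> (\<And>f. f \<in> F \<Longrightarrow> f ` W \<subseteq> W) \<Longrightarrow> W = {0} \<or> W = V"
  unfolding irreducible_on_def by simp

lemma irreducible_on_subspace: "irreducible_on F V \<Longrightarrow> subspace V"
  and irreducible_on_endo: "irreducible_on F V \<Longrightarrow> f \<in> F \<Longrightarrow> endo f"
  and irreducible_on_closed: "irreducible_on F V \<Longrightarrow> f \<in> F \<Longrightarrow> v \<in> V \<Longrightarrow> f v \<in> V"
  unfolding irreducible_on_def by blast+

lemma irreducible_on_nonzero:
  assumes "irreducible_on F V"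
  obtains v where "v \<in> V" "v \<noteq> 0"
  using assms subspace_0[of V] unfolding irreducible_on_def by blast

text \<open>The images of one nonzero vector under all finite products of operators span \<open>V\<close>.\<close>

lemma irreducible_on_countable_span:
  assumes F: "countable F" and irr: "irreducible_on F V"
  obtains W where "countable W" "V = span W"
proof -
  obtain v where v: "v \<in> V" "v \<noteq> 0"
    using irreducible_on_nonzero[OF irr] .
  define W where "W = (\<lambda>w. foldr (\<lambda>f x. f x) w v) ` lists F"
  have mem: "foldr (\<lambda>f x. f x) w v \<in> V" if "w \<in> lists F" for w
    using that v by (induction w) (auto intro: irreducible_on_closed[OF irr])
  have "span W = V"
  proof (rule irreducible_onD[OF irr])
    show "span W \<subseteq> V"
      using mem irreducible_on_subspace[OF irr] by (intro span_minimal) (auto simp: W_def)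
    show "f w \<in> span W" if f: "f \<in> F" and "w \<in> span W" for f w
      using that(2)
    proof (induction rule: span_induct_alt)
      case base
      then show ?case
        using irreducible_on_endo[OF irr f] by (simp add: endo_zero span_zero)
    next
      case (step c x y)
      then obtain l where l: "l \<in> lists F" "x = foldr (\<lambda>f x. f x) l v"
        by (auto simp: W_def)
      then have "f x = foldr (\<lambda>f x. f x) (f # l) v" "f # l \<in> lists F"
        using f by auto
      then have "f x \<in> span W"
        unfolding W_def by (intro span_base) blast
      then show ?case
        using irreducible_on_endo[OF irr f] step by (simp add: endo_add endo_scale span_add span_scale)
    qed
    show "v \<in> span W"
      by (rule span_base) (auto simp: W_def intro!: image_eqI[of _ _ "[]"])
  qed (use v in auto)
  moreover have "countable W"
    using F by (auto simp: W_def)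
  ultimately show ?thesis
    using that by blast
qed

end

locale uncountable_closed_vector_space = operator_space scale
  for scale :: "'k::alg_closed_field \<Rightarrow> 'v::ab_group_add \<Rightarrow> 'v" +
  assumes uncountable_scalars: "uncountable (UNIV :: 'k set)"
begin

text \<open>Over an algebraically closed field, \<open>p(T)\<close> is a product of factors \<open>T - c\<close>.\<close>

lemma poly_act_injective:
  assumes T: "endo T" "subspace V" "T ` V \<subseteq> V"
    and inj: "\<And>c v. v \<in> V \<Longrightarrow> T v = scale c v \<Longrightarrow> v = 0"
    and "p \<noteq> 0" "v \<in> V" "poly_act T p v = 0"
  shows "v = 0"
  using assms(5-7)
proof (induction "degree p" arbitrary: p)
  case 0
  then obtain a where "p = [:a:]" "a \<noteq> 0"
    by (metis degree_eq_zeroE pCons_0_0)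
  then show ?case
    using 0 T by (simp add: poly_act_pCons endo_zero)
next
  case (Suc d)
  obtain c where "poly p c = 0"
    using alg_closed_imp_poly_has_root[of p] Suc.hyps(2) by auto
  then obtain q where q: "p = [:- c, 1:] * q"
    by (auto simp: poly_eq_0_iff_dvd)
  have "q \<noteq> 0" using q Suc.prems by auto
  then have "degree p = Suc (degree q)"
    unfolding q by (subst degree_mult_eq) auto
  moreover have "poly_act T q v = 0"
  proof (rule inj)
    show "poly_act T q v \<in> V"
      using T Suc.prems by (intro poly_act_in_subspace)
    show "T (poly_act T q v) = scale c (poly_act T q v)"
      using Suc.prems(3) poly_act_linear_factor_outer[OF T(1), of c q v] q by simp
  qed
  ultimately show ?case
    using Suc \<open>q \<noteq> 0\<close> by simp
qed

text \<open>Dixmier's form of Schur's lemma. If no \<open>T - c\<close> vanishes on \<open>V\<close>, then each \<open>T - c\<close> is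
  bijective on \<open>V\<close>, since its kernel and its image are invariant. For a fixed \<open>v \<noteq> 0\<close> the vectors
  \<open>(T - c)\<^sup>-\<^sup>1 v\<close> are then linearly independent: a linear relation between them becomes, after
  clearing denominators, a nonzero polynomial in \<open>T\<close> that kills \<open>v\<close>, although such a polynomial
  is a product of injective factors. So \<open>V\<close> contains uncountably many independent vectors, but it is
  spanned by the countably many images of \<open>v\<close>.\<close>

lemma schur_dixmier:
  assumes F: "countable F" and irr: "irreducible_on F V"
    and T: "endo T" "T ` V \<subseteq> V" "\<And>f v. f \<in> F \<Longrightarrow> v \<in> V \<Longrightarrow> T (f v) = f (T v)"
  shows "\<exists>c. \<forall>v\<in>V. T v = scale c v"
proof (rule ccontr)
  assume "\<not> ?thesis"
  then have ne: "\<exists>v\<in>V. T v \<noteq> scale c v" for c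
    by blast
  note V = irreducible_on_subspace[OF irr]
    and FV = irreducible_on_endo[OF irr] irreducible_on_closed[OF irr]
  obtain v where v: "v \<in> V" "v \<noteq> 0"
    using irreducible_on_nonzero[OF irr] .
  have inj: "w = 0" if "w \<in> V" "T w = scale c w" for c w
  proof (rule ccontr)
    assume "w \<noteq> 0"
    have "{w\<in>V. T w = scale c w} = V"
    proof (rule irreducible_onD[OF irr])
      show "subspace {w\<in>V. T w = scale c w}"
        using V T(1) by (auto simp: subspace_def endo_zero endo_add endo_scale algebra_simps)
      show "w \<in> {w\<in>V. T w = scale c w}" using that by simp
      show "f w \<in> {w\<in>V. T w = scale c w}" if "f \<in> F" "w \<in> {w\<in>V. T w = scale c w}" for f w
        using that T(3)[of f w] FV by (auto simp: endo_scale)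
    qed (use \<open>w \<noteq> 0\<close> in auto)
    then show False using ne[of c] by blast
  qed
  have surj: "\<exists>u\<in>V. T u - scale c u = v" for c
  proof -
    define R where "R = (\<lambda>w. T w - scale c w) ` V"
    have endoR: "endo (\<lambda>w. T w - scale c w)"
      using T(1) by (intro endoI) (simp_all add: endo_add endo_scale algebra_simps)
    obtain w where w: "w \<in> V" "T w \<noteq> scale c w" using ne by blast
    have "R = V"
    proof (rule irreducible_onD[OF irr])
      show "subspace R"
        unfolding R_def using module_hom.subspace_image[OF module_hom_linearI[OF endoR] V] .
      show "R \<subseteq> V"
        using T V by (auto simp: R_def intro!: subspace_diff subspace_scale)
      show "T w - scale c w \<in> R" "T w - scale c w \<noteq> 0"
        using w by (auto simp: R_def)
      fix f r assume f: "f \<in> F" and "r \<in> R"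
      then obtain x where "x \<in> V" "r = T x - scale c x" by (auto simp: R_def)
      then have "f r = T (f x) - scale c (f x)" "f x \<in> V"
        using f T FV by (auto simp: endo_diff endo_scale)
      then show "f r \<in> R" by (auto simp: R_def)
    qed
    then show ?thesis using v by (force simp: R_def)
  qed
  then obtain u where u: "\<And>c. u c \<in> V" "\<And>c. T (u c) - scale c (u c) = v"
    by metis
  have indep: "\<alpha> c = 0" if C: "finite C" "c \<in> C" and zero: "(\<Sum>d\<in>C. scale (\<alpha> d) (u d)) = 0" for C \<alpha> c
  proof -
    \<comment> \<open>\<open>P C\<close> is the common denominator of the \<open>(T - d)\<^sup>-\<^sup>1\<close>; it turns \<open>u d\<close> into a polynomial in \<open>T\<close>
      applied to \<open>v\<close>.\<close>
    define P where "P = (\<lambda>D :: 'k set. \<Prod>d\<in>D. [:- d, 1:])"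
    have Pu: "poly_act T (P C) (u d) = poly_act T (P (C - {d})) v" if "d \<in> C" for d
    proof -
      have "P C = [:- d, 1:] * P (C - {d})"
        unfolding P_def using C that by (subst prod.remove[of C d]) auto
      then show ?thesis
        using poly_act_linear_factor_inner[OF T(1), of d "P (C - {d})" "u d"] u(2) by simp
    qed
    have "poly_act T (\<Sum>d\<in>C. smult (\<alpha> d) (P (C - {d}))) v
      = (\<Sum>d\<in>C. scale (\<alpha> d) (poly_act T (P C) (u d)))"
      using T(1) Pu by (simp add: poly_act_sum poly_act_smult)
    also have "\<dots> = poly_act T (P C) (\<Sum>d\<in>C. scale (\<alpha> d) (u d))"
      using endo_poly_act[OF T(1)] by (simp add: endo_sum endo_scale)
    also have "\<dots> = 0"
      using endo_poly_act[OF T(1)] by (simp add: zero endo_zero)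
    finally have "(\<Sum>d\<in>C. smult (\<alpha> d) (P (C - {d}))) = 0"
      using poly_act_injective[OF T(1) V T(2), of "\<Sum>d\<in>C. smult (\<alpha> d) (P (C - {d}))" v] inj v by blast
    \<comment> \<open>At the point \<open>c\<close> all summands with \<open>d \<noteq> c\<close> vanish.\<close>
    then have "0 = poly (\<Sum>d\<in>C. smult (\<alpha> d) (P (C - {d}))) c"
      by simp
    also have "\<dots> = (\<Sum>d\<in>C. \<alpha> d * (\<Prod>e\<in>C - {d}. c - e))"
      by (simp add: poly_sum poly_prod P_def)
    also have "\<dots> = (\<Sum>d\<in>{c}. \<alpha> d * (\<Prod>e\<in>C - {d}. c - e))"
      using C by (intro sum.mono_neutral_right) auto
    finally show ?thesis
      using C by simp
  qed
  have inj_u: "inj u"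
  proof (rule injI)
    fix c d assume "u c = u d"
    then have "scale c (u c) = scale d (u c)"
      using u(2)[of c] u(2)[of d] by (metis add_diff_cancel_left' diff_eq_eq)
    moreover have "u c \<noteq> 0"
      using u(2)[of c] v T(1) by (auto simp: endo_zero)
    ultimately show "c = d" by simp
  qed
  have "independent (range u)"
    unfolding independent_explicit_module
  proof (intro allI impI)
    fix t \<beta> x
    assume t: "finite t" "t \<subseteq> range u" "(\<Sum>x\<in>t. scale (\<beta> x) x) = 0" "x \<in> t"
    obtain C where C: "t = u ` C"
      using t(2) by (auto simp: subset_image_iff)
    then have "finite C" "(\<Sum>d\<in>C. scale (\<beta> (u d)) (u d)) = 0"
      using t inj_u by (auto simp: finite_image_iff inj_on_def sum.reindex)
    then show "\<beta> x = 0"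
      using indep[of C _ "\<lambda>d. \<beta> (u d)"] C t(4) by auto
  qed
  moreover obtain W where "countable W" "V = span W"
    using irreducible_on_countable_span[OF F irr] .
  ultimately have "countable (range u)"
    using countable_independent_in_countable_span u(1) by blast
  then show False
    using uncountable_scalars inj_u countable_image_inj_on by blast
qed

end

section \<open>Families of operators with the Chinese relations\<close>

context operator_space
begin

definition chinese_on :: "nat set \<Rightarrow> (nat \<Rightarrow> 'v \<Rightarrow> 'v) \<Rightarrow> 'v set \<Rightarrow> bool"
  where "chinese_on S a V \<longleftrightarrow>
    (\<forall>i\<in>S. \<forall>j\<in>S. \<forall>k\<in>S. \<forall>v\<in>V. i \<le> j \<longrightarrow> j \<le> k \<longrightarrow>
      a j (a k (a i v)) = a k (a j (a i v)) \<and> a k (a j (a i v)) = a k (a i (a j v)))"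

definition monomial_on :: "nat set \<Rightarrow> (nat \<Rightarrow> 'v \<Rightarrow> 'v) \<Rightarrow> 'v set \<Rightarrow> bool"
  where "monomial_on S a V \<longleftrightarrow>
    (\<exists>E. independent E \<and> span E = V \<and> (\<forall>i\<in>S. \<forall>e\<in>E. \<exists>c. \<exists>f\<in>E. a i e = scale c f))"

lemma chinese_on_subset: "chinese_on S a V \<Longrightarrow> S' \<subseteq> S \<Longrightarrow> chinese_on S' a V"
  unfolding chinese_on_def by blast

end

locale chinese_irreducible = uncountable_closed_vector_space scale
  for scale :: "'k::alg_closed_field \<Rightarrow> 'v::ab_group_add \<Rightarrow> 'v" +
  fixes S :: "nat set" and a :: "nat \<Rightarrow> 'v \<Rightarrow> 'v" and V :: "'v set"
  assumes finite_S: "finite S"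
    and chinese: "chinese_on S a V"
    and irr: "irreducible_on (a ` S) V"
begin

lemma endo_a: "i \<in> S \<Longrightarrow> endo (a i)"
  using irreducible_on_endo[OF irr] by blast

lemma a_closed: "i \<in> S \<Longrightarrow> v \<in> V \<Longrightarrow> a i v \<in> V"
  using irreducible_on_closed[OF irr] by blast

lemmas subspace_V = irreducible_on_subspace[OF irr]

lemmas a_linear = endo_a[THEN endo_add] endo_a[THEN endo_scale] endo_a[THEN endo_diff]
  endo_a[THEN endo_zero]

lemma rel_swap_outer:
  "i \<in> S \<Longrightarrow> j \<in> S \<Longrightarrow> k \<in> S \<Longrightarrow> i \<le> j \<Longrightarrow> j \<le> k \<Longrightarrow> v \<in> V \<Longrightarrow> a j (a k (a i v)) = a k (a j (a i v))"
  using chinese unfolding chinese_on_def by blast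

lemma rel_swap_inner:
  "i \<in> S \<Longrightarrow> j \<in> S \<Longrightarrow> k \<in> S \<Longrightarrow> i \<le> j \<Longrightarrow> j \<le> k \<Longrightarrow> v \<in> V \<Longrightarrow> a k (a j (a i v)) = a k (a i (a j v))"
  using chinese unfolding chinese_on_def by blast

text \<open>The form in which the relations are mostly used: \<open>a\<^sub>k a\<^sub>i\<close> commutes with \<open>a\<^sub>j\<close>.\<close>

lemma rel_commute:
  "i \<in> S \<Longrightarrow> j \<in> S \<Longrightarrow> k \<in> S \<Longrightarrow> i \<le> j \<Longrightarrow> j \<le> k \<Longrightarrow> v \<in> V \<Longrightarrow> a k (a i (a j v)) = a j (a k (a i v))"
  using rel_swap_inner[of i j k v] rel_swap_outer[of i j k v] by simp

lemma irreducible_drop_scalar: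
  assumes i: "i \<in> S" and c: "\<And>v. v \<in> V \<Longrightarrow> a i v = scale c v"
  shows "irreducible_on (a ` (S - {i})) V"
  unfolding irreducible_on_def
proof (intro conjI allI impI)
  show "subspace V" "V \<noteq> {0}" "\<forall>f\<in>a ` (S - {i}). endo f \<and> f ` V \<subseteq> V"
    using irr unfolding irreducible_on_def by blast+
  fix W assume W: "subspace W \<and> W \<subseteq> V \<and> (\<forall>f\<in>a ` (S - {i}). f ` W \<subseteq> W)"
  have "f ` W \<subseteq> W" if "f \<in> a ` S" for f
  proof -
    have "a i ` W \<subseteq> W"
      using W c by (auto simp: subset_iff intro: subspace_scale)
    then show ?thesis using W that by blast
  qed
  then show "W = {0} \<or> W = V"
    using W irreducible_on_cases[OF irr, of W] by simp
qed

lemma monomial_drop_scalar: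
  assumes i: "i \<in> S" and c: "\<And>v. v \<in> V \<Longrightarrow> a i v = scale c v"
    and mon: "monomial_on (S - {i}) a V"
  shows "monomial_on S a V"
proof -
  obtain E where E: "independent E" "span E = V"
    "\<And>j e. j \<in> S - {i} \<Longrightarrow> e \<in> E \<Longrightarrow> \<exists>c. \<exists>f\<in>E. a j e = scale c f"
    using mon unfolding monomial_on_def by blast
  have "\<exists>c. \<exists>f\<in>E. a j e = scale c f" if "j \<in> S" "e \<in> E" for j e
  proof (cases "j = i")
    case True
    moreover have "e \<in> V" using E(2) that span_base by blast
    ultimately show ?thesis using c that by blast
  qed (use E(3) that in blast)
  then show ?thesis
    unfolding monomial_on_def using E by blast
qed

definition killed_from :: "nat \<Rightarrow> 'v set"
  where "killed_from t = {v \<in> V. \<forall>j\<in>S. t \<le> j \<longrightarrow> a j v = 0}"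

lemma subspace_killed_from: "subspace (killed_from t)"
  using subspace_V by (auto simp: killed_from_def subspace_def a_linear)

end

section \<open>The threshold between lower and upper generators\<close>

locale chinese_threshold = chinese_irreducible scale S a V
  for scale :: "'k::alg_closed_field \<Rightarrow> 'v::ab_group_add \<Rightarrow> 'v" and S a V +
  fixes s :: nat
  assumes killed_s: "killed_from s = {0}" and killed_Suc: "killed_from (Suc s) \<noteq> {0}"
begin

definition lower :: "nat set" where "lower = {i\<in>S. i \<le> s}"
definition upper :: "nat set" where "upper = {j\<in>S. s < j}"
definition N :: "'v set" where "N = killed_from (Suc s)"

lemma s_in_S: "s \<in> S"
proof (rule ccontr)
  assume "s \<notin> S"
  then have "killed_from s = killed_from (Suc s)"
    unfolding killed_from_def by (metis Suc_le_eq le_neq_implies_less less_imp_le)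
  then show False using killed_s killed_Suc by simp
qed

lemma lowerD: "i \<in> lower \<Longrightarrow> i \<in> S" "i \<in> lower \<Longrightarrow> i \<le> s"
  and upperD: "j \<in> upper \<Longrightarrow> j \<in> S" "j \<in> upper \<Longrightarrow> s < j"
  by (auto simp: lower_def upper_def)

lemma S_cases: "i \<in> S \<Longrightarrow> i \<in> lower \<or> i \<in> upper"
  by (auto simp: lower_def upper_def)

lemma s_lower: "s \<in> lower"
  using s_in_S by (simp add: lower_def)

lemma N_V: "v \<in> N \<Longrightarrow> v \<in> V"
  and N_killed: "v \<in> N \<Longrightarrow> j \<in> upper \<Longrightarrow> a j v = 0"
  by (auto simp: N_def killed_from_def upper_def)

lemma N_I: "v \<in> V \<Longrightarrow> (\<And>j. j \<in> upper \<Longrightarrow> a j v = 0) \<Longrightarrow> v \<in> N"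
  by (auto simp: N_def killed_from_def upper_def)

lemma subspace_N: "subspace N"
  unfolding N_def by (rule subspace_killed_from)

lemma N_nonzero: obtains v where "v \<in> N" "v \<noteq> 0"
  using killed_Suc subspace_0[OF subspace_N] unfolding N_def by blast

text \<open>The commutator of two lower generators is killed by every \<open>a\<^sub>j\<close> with \<open>j \<ge> s\<close>, hence lies in
  \<open>killed_from s = {0}\<close>.\<close>

lemma lower_commute:
  assumes i: "i \<in> lower" and l: "l \<in> lower" and v: "v \<in> V"
  shows "a i (a l v) = a l (a i v)"
proof -
  have "a j (a i (a l v)) = a j (a l (a i v))" if "j \<in> S" "s \<le> j" for j
    using i l v that rel_swap_inner[of i l j v] rel_swap_inner[of l i j v]
    by (cases "i \<le> l") (auto simp: lower_def)
  then have "a i (a l v) - a l (a i v) \<in> killed_from s"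
    using lowerD i l v by (auto simp: killed_from_def a_linear a_closed intro!: subspace_diff[OF subspace_V])
  then show ?thesis
    using killed_s by simp
qed

text \<open>Since \<open>a\<^sub>l a\<^sub>i\<close> and \<open>a\<^sub>j a\<^sub>i\<close> commute with the generators in between, whichever of \<open>a\<^sub>l\<close>, \<open>a\<^sub>j\<close> has the
  smaller index can be moved to the right end of \<open>a\<^sub>l a\<^sub>j a\<^sub>i\<close>, where it kills \<open>v\<close>.\<close>

lemma pair_in_N:
  assumes i: "i \<in> lower" and j: "j \<in> upper" and v: "v \<in> N"
  shows "a j (a i v) \<in> N"
proof (rule N_I)
  note ij = lowerD[OF i] upperD[OF j] N_V[OF v]
  show "a j (a i v) \<in> V" using ij by (simp add: a_closed)
  fix l assume l: "l \<in> upper"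
  note l' = upperD[OF l]
  have "a j (a i (a l v)) = 0" "a l (a i (a j v)) = 0"
    using N_killed[OF v] l j ij l' by (simp_all add: a_linear)
  then show "a l (a j (a i v)) = 0"
    using ij l' rel_commute[of i j l v] rel_commute[of i l j v] rel_swap_outer[of i j l v] rel_swap_outer[of i l j v]
    by (cases "j \<le> l") auto
qed

inductive_set lower_span :: "'v set \<Rightarrow> 'v set" for X :: "'v set"
  where
    base: "x \<in> X \<Longrightarrow> x \<in> lower_span X"
  | zero: "0 \<in> lower_span X"
  | add: "x \<in> lower_span X \<Longrightarrow> y \<in> lower_span X \<Longrightarrow> x + y \<in> lower_span X"
  | scale: "x \<in> lower_span X \<Longrightarrow> scale c x \<in> lower_span X"
  | lower: "x \<in> lower_span X \<Longrightarrow> i \<in> lower \<Longrightarrow> a i x \<in> lower_span X"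

lemma lower_span_subset_V:
  assumes "X \<subseteq> V" "y \<in> lower_span X"
  shows "y \<in> V"
  using assms(2)
  by induction (use assms(1) subspace_V lowerD in \<open>auto intro: subspace_0 subspace_add subspace_scale a_closed\<close>)

lemma pair_below:
  assumes "i \<in> lower" "l \<in> lower" "j \<in> upper" "v \<in> V" "i \<le> l"
  shows "a j (a i (a l v)) = a l (a j (a i v))"
  using assms lowerD(1) upperD(1) rel_commute[of i l j v] lowerD(2)[of l] upperD(2)[of j] by auto

text \<open>The span is invariant under an upper \<open>a\<^sub>j\<close> because in a product \<open>a\<^sub>j a\<^sub>i a\<^sub>l \<dots>\<close> with lower \<open>i, l, \<dots>\<close>
  the lower generators commute, so that the one with least index can be put next to \<open>a\<^sub>j\<close>; this pair then commutes
  with all other factors and reaches \<open>X\<close>, which it preserves.\<close>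

lemma lower_span_eq_V:
  assumes X: "X \<subseteq> N" "x \<in> X" "x \<noteq> 0"
    and pair: "\<And>i j x. i \<in> lower \<Longrightarrow> j \<in> upper \<Longrightarrow> x \<in> X \<Longrightarrow> a j (a i x) \<in> X"
  shows "lower_span X = V"
proof (rule irreducible_onD[OF irr])
  have XV: "X \<subseteq> V" using X N_V by blast
  show "subspace (lower_span X)"
    by (rule subspaceI) (auto intro: lower_span.intros)
  show "lower_span X \<subseteq> V"
    using lower_span_subset_V[OF XV] by blast
  show "x \<in> lower_span X" "x \<noteq> 0"
    using X by (auto intro: lower_span.base)
  \<comment> \<open>The products \<open>a\<^sub>j a\<^sub>i y\<close> must be carried through the induction, since \<open>y\<close> itself may begin with a
    lower generator that has to be exchanged with \<open>a\<^sub>i\<close>.\<close>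
  have up: "y \<in> V \<and> (\<forall>j\<in>upper. a j y \<in> lower_span X \<and> (\<forall>i\<in>lower. a j (a i y) \<in> lower_span X))"
    if "y \<in> lower_span X" for y
    using that
  proof induction
    case (base x)
    then have "x \<in> N" using X by blast
    then show ?case
      using base pair N_V N_killed by (auto intro: lower_span.intros)
  next
    case (lower y l)
    then have y: "y \<in> V" and l: "l \<in> lower" by auto
    have "a j (a i (a l y)) \<in> lower_span X" if i: "i \<in> lower" and j: "j \<in> upper" for i j
    proof (cases "i \<le> l")
      case True
      then show ?thesis
        using lower i j pair_below[OF i l j y True] by (simp add: lower_span.lower)
    next
      case False
      have "a j (a i (a l y)) = a j (a l (a i y))"
        using lower_commute[OF i l y] by simp
      also have "\<dots> = a i (a j (a l y))"
        using False i j l y by (intro pair_below) auto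
      finally show ?thesis
        using lower i j by (simp add: lower_span.lower)
    qed
    then show ?case
      using lower lowerD(1) by (auto intro: a_closed)
  next
    case zero
    then show ?case
      using subspace_0[OF subspace_V] lowerD upperD by (auto simp: a_linear intro: lower_span.zero)
  next
    case (add x y)
    then show ?case
      using subspace_add[OF subspace_V] lowerD upperD by (auto simp: a_linear intro: lower_span.add)
  next
    case (scale x c)
    then show ?case
      using subspace_scale[OF subspace_V] lowerD upperD by (auto simp: a_linear intro: lower_span.scale)
  qed
  fix f w assume "f \<in> a ` S" "w \<in> lower_span X"
  then show "f w \<in> lower_span X"
    using up S_cases by (auto intro: lower_span.lower)
qed

section \<open>Scalar generators and irreducibility of the common kernel\<close>

definition R :: "'v set"
  where "R = {v \<in> N. \<forall>j\<in>upper. a j (a s v) = 0}"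

lemma R_N: "v \<in> R \<Longrightarrow> v \<in> N"
  by (simp add: R_def)

lemma subspace_R: "subspace R"
  using subspace_N lowerD(1)[OF s_lower] upperD(1)
  by (auto simp: R_def subspace_def a_linear)

text \<open>With \<open>B\<^sub>j\<^sub>i = a\<^sub>j a\<^sub>i\<close> this reads \<open>B\<^sub>j\<^sub>l B\<^sub>k\<^sub>i = B\<^sub>j\<^sub>i B\<^sub>k\<^sub>l = B\<^sub>k\<^sub>l B\<^sub>j\<^sub>i\<close>: pairs with nested index
  intervals commute, and their product is also that of the crossing pairs with the same four indices, but of
  those in one order only. All further calculations with pairs rest on these identities.\<close>

lemma pair_exchange:
  assumes i: "i \<in> lower" and l: "l \<in> lower" and j: "j \<in> upper" and k: "k \<in> upper"
    and le: "i \<le> l" "k \<le> j" and v: "v \<in> V"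
  shows "a j (a l (a k (a i v))) = a j (a i (a k (a l v)))"
    and "a j (a i (a k (a l v))) = a k (a l (a j (a i v)))"
proof -
  note S = lowerD[OF i] lowerD[OF l] upperD[OF j] upperD[OF k]
  have lk: "l \<le> k" using S by simp
  have "a j (a l (a k (a i v))) = a j (a k (a i (a l v)))"
    using rel_commute[of i l k v] S le lk v by simp
  also have "\<dots> = a k (a j (a i (a l v)))"
    using rel_swap_outer[of i k j "a l v"] S le lk v by (simp add: a_closed)
  also have "\<dots> = a j (a i (a k (a l v)))"
    using rel_commute[of i k j "a l v"] S le lk v by (simp add: a_closed)
  finally show "a j (a l (a k (a i v))) = a j (a i (a k (a l v)))" .
  have "a j (a i (a k (a l v))) = a k (a j (a i (a l v)))"
    using rel_commute[of i k j "a l v"] S le lk v by (simp add: a_closed)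
  also have "\<dots> = a k (a l (a j (a i v)))"
    using rel_commute[of i l j v] S le lk v by simp
  finally show "a j (a i (a k (a l v))) = a k (a l (a j (a i v)))" .
qed

lemma pair_R:
  assumes i: "i \<in> lower" and j: "j \<in> upper" and v: "v \<in> R"
  shows "a j (a i v) \<in> R"
  unfolding R_def
proof (intro CollectI conjI ballI)
  have vN: "v \<in> N" and vV: "v \<in> V" using v R_N N_V by auto
  show "a j (a i v) \<in> N" by (rule pair_in_N[OF i j vN])
  fix l assume l: "l \<in> upper"
  have z: "a l (a s v) = 0" "a j (a s v) = 0"
    using v l j by (auto simp: R_def)
  note S = lowerD[OF i] lowerD[OF s_lower] upperD[OF j] upperD[OF l]
  show "a l (a s (a j (a i v))) = 0"
  proof (cases "j \<le> l")
    case True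
    then show ?thesis
      using pair_exchange(1)[OF i s_lower l j S(2) True vV] z S by (simp add: a_linear)
  next
    case False
    then show ?thesis
      using pair_exchange(2)[OF i s_lower j l S(2) _ vV] z S by (simp add: a_linear)
  qed
qed

lemma s_central_on_lower_image:
  assumes "i \<in> lower" "j \<in> upper" "v \<in> V"
  shows "a j (a s (a i v)) = a s (a j (a i v))"
  using assms lowerD[OF assms(1)] upperD[OF assms(2)] s_in_S rel_swap_outer[of i s j v] by simp

text \<open>It must be shown that \<open>a\<^sub>s\<close> commutes with the upper generators. On \<open>R\<close> both products are zero, on the image
  of a lower generator they agree by the relations, and \<open>R\<close> together with such images spans \<open>V\<close>.\<close>

lemma s_scalar_if_R_nonzero:
  assumes "R \<noteq> {0}"
  shows "\<exists>c. \<forall>v\<in>V. a s v = scale c v"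
proof -
  obtain r where r: "r \<in> R" "r \<noteq> 0"
    using assms subspace_0[OF subspace_R] by blast
  have RN: "R \<subseteq> N" using R_N by blast
  have RV: "R \<subseteq> V" using R_N N_V by blast
  have V: "lower_span R = V"
    by (rule lower_span_eq_V[OF RN r]) (rule pair_R)
  have up: "a s (a j v) = a j (a s v)" if "v \<in> lower_span R" "j \<in> upper" for j v
    using that(1)
  proof induction
    case (base x)
    then show ?case
      using that N_killed[of x j] s_in_S by (auto simp: R_def a_linear)
  next
    case (lower x i)
    then show ?case
      using s_central_on_lower_image[OF _ that(2), of i x] V by simp
  qed (use that upperD s_in_S in \<open>auto simp: a_linear\<close>)
  show ?thesis
  proof (rule schur_dixmier[OF _ irr])
    show "countable (a ` S)" using finite_S by (simp add: countable_finite)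
    show "endo (a s)" "a s ` V \<subseteq> V" using s_in_S endo_a a_closed by auto
    fix f v assume "f \<in> a ` S" "v \<in> V"
    then show "a s (f v) = f (a s v)"
      using S_cases up V lower_commute[OF s_lower] by blast
  qed
qed

definition pairs :: "('v \<Rightarrow> 'v) set"
  where "pairs = (\<lambda>(j, i). a j \<circ> a i) ` (upper \<times> lower)"

text \<open>Let \<open>X\<close> be nonzero and invariant under the pairs. As \<open>V\<close> is generated from \<open>X\<close> by the lower
  generators, each \<open>v \<in> N\<close> is the sum of some \<open>x \<in> X\<close> and some \<open>d\<close> in the sum of the images of the lower
  generators. Such \<open>d\<close> satisfy \<open>a\<^sub>j a\<^sub>s d = a\<^sub>s a\<^sub>j d\<close> for upper \<open>j\<close>, and here this is \<open>0\<close> since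
  \<open>d = v - x\<close> lies in \<open>N\<close>. So \<open>d \<in> R = 0\<close>, and \<open>v = x\<close>.\<close>

lemma N_irreducible:
  assumes R0: "R = {0}"
  shows "irreducible_on pairs N"
  unfolding irreducible_on_def
proof (intro conjI allI impI)
  show "subspace N" by (rule subspace_N)
  show "N \<noteq> {0}" using N_nonzero by blast
  show "\<forall>f\<in>pairs. endo f \<and> f ` N \<subseteq> N"
    using pair_in_N endo_comp endo_a lowerD(1) upperD(1) by (force simp: pairs_def)
  fix X assume X: "subspace X \<and> X \<subseteq> N \<and> (\<forall>f\<in>pairs. f ` X \<subseteq> X)"
  then have pair: "a j (a i x) \<in> X" if "i \<in> lower" "j \<in> upper" "x \<in> X" for i j x
    using that by (force simp: pairs_def)
  show "X = {0} \<or> X = N"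
  proof (rule disjCI)
    assume "X \<noteq> N"
    show "X = {0}"
    proof (rule ccontr)
      assume "X \<noteq> {0}"
      then obtain x where x: "x \<in> X" "x \<noteq> 0"
        using X subspace_0[of X] by blast
      have V: "lower_span X = V"
        using lower_span_eq_V[of X x] X x pair by blast
      define D where "D = {d. \<forall>j\<in>upper. a j (a s d) = a s (a j d)}"
      have D: "subspace D"
        using s_in_S upperD(1) by (auto simp: D_def subspace_def a_linear)
      have split: "\<exists>x\<in>X. \<exists>d\<in>D. y = x + d" if "y \<in> lower_span X" for y
        using that
      proof induction
        case (base y)
        then show ?case
          using subspace_0[OF D] by force
      next
        case zero
        then show ?case
          using X subspace_0[of X] subspace_0[OF D] by force
      next
        case (add y z)
        then obtain x d x' d' where "x \<in> X" "x' \<in> X" "d \<in> D" "d' \<in> D" "y = x + d" "z = x' + d'"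
          by blast
        moreover have "x + d + (x' + d') = (x + x') + (d + d')"
          by simp
        ultimately show ?case
          using X subspace_add[of X x x'] subspace_add[OF D, of d d'] by blast
      next
        case (scale y c)
        then obtain x d where "x \<in> X" "d \<in> D" "y = x + d"
          by blast
        then show ?case
          using X subspace_scale[of X x c] subspace_scale[OF D, of d c] scale_right_distrib by blast
      next
        case (lower y i)
        then have "a i y \<in> D"
          using s_central_on_lower_image[OF lower(2)] V by (simp add: D_def)
        then show ?case
          using X subspace_0[of X] by force
      qed
      have "v \<in> X" if v: "v \<in> N" for v
      proof -
        obtain x d where x: "x \<in> X" "d \<in> D" "v = x + d"
          using split[of v] N_V[OF v] V by blast
        then have "d \<in> N"
          using v X subspace_diff[OF subspace_N v, of x] by auto
        then have "d \<in> R"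
          using x N_killed s_in_S by (auto simp: R_def D_def a_linear)
        then show ?thesis using R0 x by simp
      qed
      then show False using X \<open>X \<noteq> N\<close> by blast
    qed
  qed
qed

section \<open>The bicyclic pair in the middle\<close>

lemma upper_nonempty:
  assumes "R = {0}"
  shows "upper \<noteq> {}"
proof
  assume "upper = {}"
  then have "R = N" by (simp add: R_def)
  then show False using assms N_nonzero by blast
qed

definition k :: nat where "k = Min upper"

lemma finite_upper: "finite upper"
  using finite_S by (simp add: upper_def)

lemma k_upper: "R = {0} \<Longrightarrow> k \<in> upper"
  using Min_in[OF finite_upper upper_nonempty] by (simp add: k_def)

lemma k_le: "j \<in> upper \<Longrightarrow> k \<le> j"
  using Min_le[OF finite_upper] by (simp add: k_def)

lemma lower_span_N: "lower_span N = V"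
proof -
  obtain v where "v \<in> N" "v \<noteq> 0" using N_nonzero .
  then show ?thesis
    using lower_span_eq_V[of N v] pair_in_N by blast
qed

lemma middle_pair_scalar_on_N:
  assumes R0: "R = {0}"
  obtains \<mu> where "\<And>v. v \<in> N \<Longrightarrow> a k (a s v) = scale \<mu> v"
proof -
  note k = k_upper[OF R0]
  have "\<exists>c. \<forall>v\<in>N. (a k \<circ> a s) v = scale c v"
  proof (rule schur_dixmier[OF _ N_irreducible[OF R0]])
    show "countable pairs"
      unfolding pairs_def using finite_S
      by (intro countable_finite finite_imageI finite_cartesian_product) (auto simp: lower_def upper_def)
    show "endo (a k \<circ> a s)"
      using k s_in_S upperD by (intro endo_comp endo_a) auto
    show "(a k \<circ> a s) ` N \<subseteq> N"
      using pair_in_N[OF s_lower k] by auto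
    fix f v assume "f \<in> pairs" and v: "v \<in> N"
    then obtain i j where i: "i \<in> lower" and j: "j \<in> upper" and f: "f = a j \<circ> a i"
      by (auto simp: pairs_def)
    note S = lowerD[OF i] upperD[OF j] upperD[OF k] k_le[OF j] s_in_S N_V[OF v]
    have "a s (a j (a i v)) = a j (a i (a s v))"
      using rel_commute[of i s j v] S by simp
    moreover have "a k (a j (a i (a s v))) = a j (a i (a k (a s v)))"
      using rel_commute[of i k j "a s v"] S by (simp add: a_closed)
    ultimately show "(a k \<circ> a s) (f v) = f ((a k \<circ> a s) v)"
      by (simp add: f)
  qed
  then show ?thesis using that by auto
qed

text \<open>By \<open>pair_exchange\<close>, \<open>a\<^sub>k a\<^sub>i\<close> maps \<open>N\<close> into \<open>R = 0\<close>. So \<open>a\<^sub>k\<close> kills \<open>N\<close> and \<open>a\<^sub>i N\<close>, and, moving lower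
  generators to the front, everything that the lower generators produce from \<open>N\<close>.\<close>

lemma k_zero_if_middle_pair_zero:
  assumes R0: "R = {0}" and zero: "\<And>v. v \<in> N \<Longrightarrow> a k (a s v) = 0" and v: "v \<in> V"
  shows "a k v = 0"
proof -
  note k = k_upper[OF R0]
  note kS = upperD(1)[OF k]
  have "a k y = 0 \<and> (\<forall>i\<in>lower. a k (a i y) = 0)" if "y \<in> lower_span N" for y
    using that
  proof induction
    case (base x)
    have "a k (a i x) \<in> R" if i: "i \<in> lower" for i
      unfolding R_def
    proof (intro CollectI conjI ballI)
      show "a k (a i x) \<in> N" by (rule pair_in_N[OF i k base])
      fix j assume j: "j \<in> upper"
      show "a j (a s (a k (a i x))) = 0"
        using pair_exchange(1)[OF i s_lower j k lowerD(2)[OF i] k_le[OF j] N_V[OF base]]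
          zero[OF base] lowerD(1)[OF i] upperD(1)[OF j] by (simp add: a_linear)
    qed
    then show ?case
      using R0 N_killed[OF base k] by auto
  next
    case (lower y l)
    then have y: "y \<in> V" and l: "l \<in> lower" using lower_span_N by auto
    have "a k (a i (a l y)) = 0" if i: "i \<in> lower" for i
    proof (cases "i \<le> l")
      case True
      then show ?thesis
        using pair_below[OF i l k y] lower i lowerD(1)[OF l] by (simp add: a_linear)
    next
      case False
      then show ?thesis
        using pair_below[OF l i k y] lower_commute[OF i l y] lower l lowerD(1)[OF i] by (simp add: a_linear)
    qed
    then show ?case using lower by blast
  qed (use kS lowerD(1) in \<open>auto simp: a_linear\<close>)
  then show ?thesis using v lower_span_N by blast
qed

context
  fixes \<mu> :: 'k
  assumes R0: "R = {0}" and mu: "\<mu> \<noteq> 0" and middle: "\<And>v. v \<in> N \<Longrightarrow> a k (a s v) = scale \<mu> v"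
begin

lemma k: "k \<in> upper" and kS: "k \<in> S"
  using k_upper[OF R0] upperD(1) by auto

lemma pair_through_middle:
  assumes i: "i \<in> lower" and j: "j \<in> upper" and v: "v \<in> N"
  shows "a j (a s (a k (a i v))) = scale \<mu> (a j (a i v))"
  using pair_exchange(1)[OF i s_lower j k lowerD(2)[OF i] k_le[OF j] N_V[OF v]]
    middle[OF v] lowerD(1)[OF i] upperD(1)[OF j] by (simp add: a_linear)

text \<open>The difference \<open>u\<close> of the two sides lies in \<open>N\<close>, so \<open>a\<^sub>k a\<^sub>s u = \<mu> u\<close>; but moving \<open>a\<^sub>s\<close> to the front shows
  that \<open>a\<^sub>k a\<^sub>s u = 0\<close>.\<close>

lemma lower_through_s:
  assumes i: "i \<in> lower" and v: "v \<in> N"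
  shows "scale \<mu> (a i v) = a s (a k (a i v))"
proof -
  note iS = lowerD[OF i] and vV = N_V[OF v]
  define w where "w = a k (a i v)"
  have w: "w \<in> N" unfolding w_def by (rule pair_in_N[OF i k v])
  define u where "u = scale \<mu> (a i v) - a s w"
  have u: "u \<in> N"
  proof (rule N_I)
    show "u \<in> V"
      unfolding u_def using iS s_in_S vV N_V[OF w]
      by (intro subspace_diff[OF subspace_V] subspace_scale[OF subspace_V] a_closed)
    fix j assume j: "j \<in> upper"
    show "a j u = 0"
      using pair_through_middle[OF i j v] upperD(1)[OF j] by (simp add: u_def w_def a_linear)
  qed
  have "a k (a s (a i v)) = a s w"
    using lower_commute[OF s_lower i vV] pair_below[OF i s_lower k vV iS(2)] by (simp add: w_def)
  moreover have "a k (a s (a s w)) = scale \<mu> (a s w)"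
    using pair_below[OF s_lower s_lower k N_V[OF w]] middle[OF w] s_in_S by (simp add: a_linear)
  ultimately have "a k (a s u) = 0"
    using s_in_S kS by (simp add: u_def a_linear)
  then have "u = 0"
    using middle[OF u] mu by simp
  then show ?thesis by (simp add: u_def w_def)
qed

text \<open>If \<open>V\<close> is viewed as the tensor product of \<open>N\<close> with the space on which \<open>a\<^sub>s\<close> is the upward shift \<open>q\<close>
  and \<open>a\<^sub>k\<close> is \<open>\<mu>\<close> times the downward shift \<open>p\<close>, then \<open>a\<^sub>i\<close> is, up to a scalar factor,
  \<open>reduced i\<close> times \<open>q\<close> for \<open>i < s\<close>, and \<open>reduced j\<close> times \<open>p\<close> for \<open>j > k\<close>. The scalar does not matter,
  since the Chinese relations are homogeneous in each generator.\<close>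

definition reduced :: "nat \<Rightarrow> 'v \<Rightarrow> 'v"
  where "reduced i = (if i < s then a k \<circ> a i else a i \<circ> a s)"

lemma reduced_cases:
  assumes "i \<in> S - {s, k}"
  obtains "i \<in> lower" "i < s" "\<And>v. reduced i v = a k (a i v)"
    | "i \<in> upper" "k < i" "\<And>v. reduced i v = a i (a s v)"
proof (cases "i < s")
  case True
  then show ?thesis using that(1) assms by (auto simp: lower_def reduced_def)
next
  case False
  then have "i \<in> upper" using assms by (auto simp: upper_def)
  then show ?thesis using that(2) False assms k_le[of i] by (auto simp: reduced_def)
qed

text \<open>A product \<open>a\<^sub>j a\<^sub>s a\<^sub>k a\<^sub>i\<close> of an upper and a lower reduced operator is \<open>\<mu> a\<^sub>j a\<^sub>i\<close> by \<open>pair_through_middle\<close>; the relations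
  then become instances of \<open>pair_exchange\<close>. Between \<open>i\<close>, \<open>j\<close>, \<open>l\<close> only the position of the gap
  from \<open>s\<close> to \<open>k\<close> distinguishes cases.\<close>

lemma chinese_reduced: "chinese_on (S - {s, k}) reduced N"
  unfolding chinese_on_def
proof (intro ballI impI)
  fix i j l v
  assume S: "i \<in> S - {s, k}" "j \<in> S - {s, k}" "l \<in> S - {s, k}" and v: "v \<in> N"
    and le: "i \<le> j" "j \<le> l"
  note sS = s_in_S kS
  have sk: "s < k" using upperD(2)[OF k] .
  have comm_lower: "a k (a x (a k (a y w))) = a k (a y (a k (a x w)))"
    if "x \<in> lower" "y \<in> lower" "w \<in> N" for x y w
    using that pair_exchange(2)[OF _ _ k k, of x y w] pair_exchange(2)[OF _ _ k k, of y x w] N_V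
    by (cases "x \<le> y") auto
  have comm_upper: "a x (a s (a y (a s w))) = a y (a s (a x (a s w)))"
    if "x \<in> upper" "y \<in> upper" "w \<in> N" for x y w
    using that pair_exchange(2)[OF s_lower s_lower, of x y w] pair_exchange(2)[OF s_lower s_lower, of y x w] N_V
    by (cases "x \<le> y") auto
  show "reduced j (reduced l (reduced i v)) = reduced l (reduced j (reduced i v))
    \<and> reduced l (reduced j (reduced i v)) = reduced l (reduced i (reduced j v))"
  proof (cases rule: reduced_cases[OF S(1)])
    case i: 1
    show ?thesis
    proof (cases rule: reduced_cases[OF S(2)])
      case j: 1
      show ?thesis
      proof (cases rule: reduced_cases[OF S(3)])
        case l: 1
        show ?thesis
          using comm_lower[OF j(1) l(1) pair_in_N[OF i(1) k v]] comm_lower[OF i(1) j(1) v]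
          by (simp add: i(3) j(3) l(3))
      next
        case l: 2
        have "a l (a j (a k (a i v))) = a l (a i (a k (a j v)))"
          "a l (a i (a k (a j v))) = a k (a j (a l (a i v)))"
          using pair_exchange[OF i(1) j(1) l(1) k le(1) k_le[OF l(1)] N_V[OF v]] by simp_all
        then show ?thesis
          using pair_through_middle[OF i(1) l(1) v]
            pair_through_middle[OF j(1) l(1) pair_in_N[OF i(1) k v]]
            pair_through_middle[OF i(1) l(1) pair_in_N[OF j(1) k v]]
            lowerD(1)[OF j(1)] kS
          by (simp add: i(3) j(3) l(3) a_linear)
      qed
    next
      case j: 2
      then have l: "l \<in> upper" "\<And>v. reduced l v = a l (a s v)"
        using reduced_cases[OF S(3)] le sk by (metis leD less_trans order_le_less_trans)+
      have "a l (a s (a j (a i v))) = a l (a i (a j (a s v)))"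
        "a l (a i (a j (a s v))) = a j (a s (a l (a i v)))"
        using pair_exchange[OF i(1) s_lower l(1) j(1) lowerD(2)[OF i(1)] le(2) N_V[OF v]] by simp_all
      then show ?thesis
        using pair_through_middle[OF i(1) l(1) v] pair_through_middle[OF i(1) j(1) v]
          pair_through_middle[OF i(1) l(1) pair_in_N[OF s_lower j(1) v]]
          upperD(1)[OF j(1)] upperD(1)[OF l(1)] s_in_S
        by (simp add: i(3) j(3) l(2) a_linear)
    qed
  next
    case i: 2
    then have j: "j \<in> upper" "\<And>v. reduced j v = a j (a s v)"
      and l: "l \<in> upper" "\<And>v. reduced l v = a l (a s v)"
      using reduced_cases[OF S(2)] reduced_cases[OF S(3)] le sk by (metis leD less_trans order_le_less_trans)+
    show ?thesis
      using comm_upper[OF j(1) l(1) pair_in_N[OF s_lower i(1) v]] comm_upper[OF i(1) j(1) v]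
      by (simp add: i(3) j(2) l(2))
  qed
qed

text \<open>All pairs can be recovered from the reduced operators, because \<open>\<mu> a\<^sub>j a\<^sub>i = (a\<^sub>j a\<^sub>s) (a\<^sub>k a\<^sub>i)\<close> on \<open>N\<close>.\<close>

lemma irreducible_reduced: "irreducible_on (reduced ` (S - {s, k})) N"
  unfolding irreducible_on_def
proof (intro conjI allI impI)
  show "subspace N" by (rule subspace_N)
  show "N \<noteq> {0}" using N_nonzero by blast
  show "\<forall>f\<in>reduced ` (S - {s, k}). endo f \<and> f ` N \<subseteq> N"
  proof (intro ballI)
    fix f assume "f \<in> reduced ` (S - {s, k})"
    then obtain i where i: "i \<in> S - {s, k}" "f = reduced i" by blast
    have "endo f"
      using i s_in_S kS by (auto simp: reduced_def intro!: endo_comp endo_a)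
    moreover have "f v \<in> N" if "v \<in> N" for v
      by (rule reduced_cases[OF i(1)]) (use i that pair_in_N k s_lower in auto)
    ultimately show "endo f \<and> f ` N \<subseteq> N" by blast
  qed
  fix X assume X: "subspace X \<and> X \<subseteq> N \<and> (\<forall>f\<in>reduced ` (S - {s, k}). f ` X \<subseteq> X)"
  have red: "reduced i x \<in> X" if "i \<in> S - {s, k}" "x \<in> X" for i x
    using X that by blast
  have mid: "a k (a s x) \<in> X" if "x \<in> X" for x
    using X that middle[of x] subspace_scale[of X x \<mu>] by auto
  have low: "a k (a i x) \<in> X" if "i \<in> lower" "x \<in> X" for i x
  proof (cases "i = s")
    case False
    then show ?thesis
      using red[of i x] that upperD(2)[OF k] by (auto simp: reduced_def lower_def)
  qed (use that mid in simp)
  have upp: "a j (a s x) \<in> X" if "j \<in> upper" "x \<in> X" for j x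
  proof (cases "j = k")
    case False
    then show ?thesis
      using red[of j x] that by (auto simp: reduced_def upper_def)
  qed (use that mid in simp)
  have pair: "a j (a i x) \<in> X" if "i \<in> lower" "j \<in> upper" "x \<in> X" for i j x
  proof -
    have "scale \<mu> (a j (a i x)) \<in> X"
      using pair_through_middle[OF that(1,2), of x] upp[OF that(2) low[OF that(1,3)]] X that by auto
    then have "scale (inverse \<mu>) (scale \<mu> (a j (a i x))) \<in> X"
      using X subspace_scale by blast
    then show ?thesis using mu by simp
  qed
  then have "f ` X \<subseteq> X" if "f \<in> pairs" for f
    using that by (auto simp: pairs_def)
  then show "X = {0} \<or> X = N"
    using irreducible_on_cases[OF N_irreducible[OF R0], of X] X by blast
qed

text \<open>The lower generators raise the exponent of \<open>a\<^sub>s\<close> by one and the upper ones lower it by one or, if it is zero, give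
  zero. Spanning is free of charge: the span is invariant and nonzero.\<close>

lemma monomial_from_reduced:
  assumes "monomial_on (S - {s, k}) reduced N"
  shows "monomial_on S a V"
proof -
  obtain E' where E': "independent E'" "span E' = N"
    and mon: "\<And>i e. i \<in> S - {s, k} \<Longrightarrow> e \<in> E' \<Longrightarrow> \<exists>c. \<exists>f\<in>E'. reduced i e = scale c f"
    using assms unfolding monomial_on_def by blast
  define E where "E = (\<Union>r. (a s ^^ r) ` E')"
  have E'N: "e \<in> N" if "e \<in> E'" for e
    using that E'(2) span_base by blast
  have pow_V: "(a s ^^ r) v \<in> V" if "v \<in> V" for r v
    using that by (induction r) (auto intro: a_closed s_in_S)
  have pow_scale: "(a s ^^ r) (scale c v) = scale c ((a s ^^ r) v)" for r c v
    by (rule endo_scale[OF endo_funpow[OF endo_a[OF s_in_S]]])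
  have pow_lower: "a i ((a s ^^ r) v) = (a s ^^ r) (a i v)" if "i \<in> lower" "v \<in> V" for i r v
    using that by (induction r) (auto simp: lower_commute[OF _ s_lower] pow_V)
  have pow_upper: "a j (a s ((a s ^^ r) v)) = (a s ^^ r) (a j (a s v))" if "j \<in> upper" "v \<in> V" for j r v
    using that by (induction r) (auto simp: pair_below[OF s_lower s_lower] pow_V)
  have low: "\<exists>c. \<exists>f\<in>E'. a k (a i e) = scale c f" if "i \<in> lower" "e \<in> E'" for i e
  proof (cases "i = s")
    case True
    then show ?thesis using middle[OF E'N[OF that(2)]] that(2) by blast
  next
    case False
    then show ?thesis
      using mon[of i e] that upperD(2)[OF k] by (auto simp: reduced_def lower_def)
  qed
  have upp: "\<exists>c. \<exists>f\<in>E'. a j (a s e) = scale c f" if "j \<in> upper" "e \<in> E'" for j e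
  proof (cases "j = k")
    case True
    then show ?thesis using middle[OF E'N[OF that(2)]] that(2) by blast
  next
    case False
    then show ?thesis
      using mon[of j e] that by (auto simp: reduced_def upper_def)
  qed
  have monE: "\<exists>c. \<exists>f\<in>E. a i x = scale c f" if i: "i \<in> S" and x: "x \<in> E" for i x
  proof -
    obtain r e where e: "e \<in> E'" "x = (a s ^^ r) e"
      using x by (auto simp: E_def)
    note eN = E'N[OF e(1)]
    note eV = N_V[OF eN]
    consider "i \<in> lower" | "i \<in> upper" using S_cases[OF i] by blast
    then show ?thesis
    proof cases
      case 1
      obtain c f where f: "f \<in> E'" "a k (a i e) = scale c f"
        using low[OF 1 e(1)] by blast
      have "scale (inverse \<mu>) (scale \<mu> (a i e)) = scale (inverse \<mu>) (a s (scale c f))"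
        using lower_through_s[OF 1 eN] f by simp
      then have "a i e = scale (inverse \<mu> * c) (a s f)"
        using mu s_in_S by (simp add: a_linear)
      then have "a i x = scale (inverse \<mu> * c) ((a s ^^ Suc r) f)"
        using pow_lower[OF 1 eV] e(2) by (simp add: pow_scale funpow_swap1)
      moreover have "(a s ^^ Suc r) f \<in> E"
        unfolding E_def using f(1) by blast
      ultimately show ?thesis by blast
    next
      case 2
      show ?thesis
      proof (cases r)
        case 0
        then have "a i x = scale 0 x"
          using N_killed[OF eN 2] e(2) by simp
        then show ?thesis using x by blast
      next
        case (Suc m)
        obtain c f where f: "f \<in> E'" "a i (a s e) = scale c f"
          using upp[OF 2 e(1)] by blast
        then have "a i x = scale c ((a s ^^ m) f)"
          using pow_upper[OF 2 eV] e(2) Suc by (simp add: pow_scale)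
        moreover have "(a s ^^ m) f \<in> E"
          unfolding E_def using f(1) by blast
        ultimately show ?thesis by blast
      qed
    qed
  qed
  have "independent E"
    unfolding E_def
  proof (rule independent_shifts[OF _ E'(1)])
    show "endo (\<lambda>v. scale (inverse \<mu>) (a k v))"
      using endo_a[OF kS] by (intro endoI) (simp_all add: endo_add endo_scale scale_right_distrib mult.commute)
    fix e assume e: "e \<in> E'"
    show "scale (inverse \<mu>) (a k e) = 0"
      using N_killed[OF E'N[OF e] k] by simp
    show "scale (inverse \<mu>) (a k (a s ((a s ^^ r) e))) = (a s ^^ r) e" for r
      using pow_upper[OF k N_V[OF E'N[OF e]]] middle[OF E'N[OF e]] mu by (simp add: pow_scale)
  qed
  moreover have "span E = V"
  proof -
    obtain v where v: "v \<in> N" "v \<noteq> 0" using N_nonzero .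
    have "E' \<subseteq> E"
      unfolding E_def by (rule subsetI, rule UN_I[of 0]) auto
    then have vE: "v \<in> span E"
      using v E'(2) span_mono by blast
    show ?thesis
    proof (rule irreducible_onD[OF irr _ _ _ vE v(2)])
      show "span E \<subseteq> V"
        using E'N N_V pow_V by (intro span_minimal subspace_V) (auto simp: E_def)
      fix f w assume "f \<in> a ` S" and w: "w \<in> span E"
      then obtain i where i: "i \<in> S" "f = a i" by blast
      show "f w \<in> span E"
        using w
      proof (induction rule: span_induct_alt)
        case base
        then show ?case using i by (simp add: a_linear span_zero)
      next
        case (step c x y)
        obtain d g where "g \<in> E" "a i x = scale d g"
          using monE[OF i(1) step(1)] by blast
        then show ?case
          using step(2) i by (simp add: a_linear span_add span_scale span_base)
      qed
    qed simp
  qed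
  ultimately show ?thesis
    unfolding monomial_on_def using monE by blast
qed

end

end

section \<open>Irreducible families with the Chinese relations are monomial\<close>

context uncountable_closed_vector_space
begin

lemma monomial_on_empty:
  assumes irr: "irreducible_on (a ` {}) V"
  shows "monomial_on {} a V"
proof -
  obtain v where v: "v \<in> V" "v \<noteq> 0"
    using irreducible_on_nonzero[OF irr] .
  have "span {v} = V"
    using irreducible_onD[OF irr, of "span {v}" v] v irreducible_on_subspace[OF irr]
    by (simp add: span_minimal span_base)
  moreover have "independent {v}"
    using v by simp
  ultimately show ?thesis
    unfolding monomial_on_def by blast
qed

theorem chinese_irreducible_monomial:
  assumes "finite S" "chinese_on S a V" "irreducible_on (a ` S) V"
  shows "monomial_on S a V"
  using assms
proof (induction "card S" arbitrary: S a V rule: less_induct)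
  case less
  interpret chinese_irreducible scale S a V
    using less.prems by unfold_locales
  have drop: "monomial_on S a V" if i: "i \<in> S" and c: "\<forall>v\<in>V. a i v = scale c v" for i c
  proof (rule monomial_drop_scalar[OF i])
    show "monomial_on (S - {i}) a V"
    proof (rule less.hyps)
      show "card (S - {i}) < card S"
        using i finite_S by (intro psubset_card_mono) auto
      show "chinese_on (S - {i}) a V"
        using chinese_on_subset[OF chinese] by blast
      show "irreducible_on (a ` (S - {i})) V"
        using irreducible_drop_scalar[OF i] c by blast
    qed (use finite_S in simp)
  qed (use c in blast)
  show ?case
  proof (cases "S = {}")
    case True
    then show ?thesis using monomial_on_empty less.prems by blast
  next
    case False
    \<comment> \<open>Beyond the largest index there is nothing to kill, so the threshold exists.\<close>
    have "killed_from (Suc (Max S)) = V"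
      using finite_S by (auto simp: killed_from_def dest: Max_ge)
    then have ex: "\<exists>t. killed_from t \<noteq> {0}"
      using irreducible_on_nonzero[OF irr] by blast
    define t where "t = (LEAST t. killed_from t \<noteq> {0})"
    have t: "killed_from t \<noteq> {0}"
      unfolding t_def by (rule LeastI_ex[OF ex])
    show ?thesis
    proof (cases t)
      case 0
      obtain v where v: "v \<in> killed_from 0" "v \<noteq> 0"
        using t subspace_0[OF subspace_killed_from] 0 by blast
      have "killed_from 0 = V"
      proof (rule irreducible_onD[OF irr subspace_killed_from _ _ v])
        show "killed_from 0 \<subseteq> V" by (auto simp: killed_from_def)
        show "f w \<in> killed_from 0" if "f \<in> a ` S" "w \<in> killed_from 0" for f w
          using that subspace_0[OF subspace_killed_from, of 0] by (auto simp: killed_from_def)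
      qed
      then have "\<forall>v\<in>V. a i v = scale 0 v" if "i \<in> S" for i
        using that by (auto simp: killed_from_def)
      then show ?thesis using drop False by blast
    next
      case (Suc s)
      have "killed_from s = {0}"
        using not_less_Least[of s "\<lambda>t. killed_from t \<noteq> {0}"] Suc by (auto simp: t_def)
      then interpret chinese_threshold scale S a V s
        using t Suc by unfold_locales auto
      show ?thesis
      proof (cases "R = {0}")
        case False
        then show ?thesis using drop[OF s_in_S] s_scalar_if_R_nonzero by blast
      next
        case True
        obtain \<mu> where mu: "\<And>v. v \<in> N \<Longrightarrow> a k (a s v) = scale \<mu> v"
          using middle_pair_scalar_on_N[OF True] by blast
        show ?thesis
        proof (cases "\<mu> = 0")
          case zero: True
          have "\<forall>v\<in>V. a k v = scale 0 v"
            using k_zero_if_middle_pair_zero[OF True] mu zero by simp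
          then show ?thesis using drop upperD(1)[OF k_upper[OF True]] by blast
        next
          case False
          have "monomial_on (S - {s, k}) reduced N"
          proof (rule less.hyps)
            show "card (S - {s, k}) < card S"
              using finite_S s_in_S by (intro psubset_card_mono) auto
            show "chinese_on (S - {s, k}) reduced N"
              by (rule chinese_reduced[OF True False mu])
            show "irreducible_on (reduced ` (S - {s, k})) N"
              by (rule irreducible_reduced[OF True False mu])
          qed (use finite_S in simp)
          then show ?thesis
            using monomial_from_reduced[OF True False mu] by simp
        qed
      qed
    qed
  qed
qed

end

section \<open>Representations of the Chinese monoid\<close>

lemma chinese_monoid_mult_class:
  "u \<in> lists {1..n} \<Longrightarrow> v \<in> lists {1..n} \<Longrightarrow>
    presentation_cong {1..n} (chinese_relations n) `` {u} \<otimes>\<^bsub>chinese_monoid n\<^esub>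
    presentation_cong {1..n} (chinese_relations n) `` {v}
    = presentation_cong {1..n} (chinese_relations n) `` {u @ v}"
  unfolding chinese_monoid_def by (rule presented_monoid_mult_class)

lemma chinese_class_eq:
  assumes "(u, v) \<in> chinese_relations n" "u \<in> lists {1..n}" "v \<in> lists {1..n}"
  shows "presentation_cong {1..n} (chinese_relations n) `` {u} = presentation_cong {1..n} (chinese_relations n) `` {v}"
  by (rule equiv_class_eq[OF equiv_presentation_cong presentation_cong.rel[OF assms]])

theorem corollary3p14:
  fixes n :: nat
    and scale :: "'k::alg_closed_field \<Rightarrow> 'v::ab_group_add \<Rightarrow> 'v"
    and \<rho> :: "nat list set \<Rightarrow> 'v \<Rightarrow> 'v"
  assumes "uncountable (UNIV :: 'k set)"
    and "n \<ge> 1"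
    and "monoid_representation (chinese_monoid n) scale \<rho>"
    and "monoid_representation.irreducible_rep (chinese_monoid n) scale \<rho>"
  shows "monoid_representation.monomial_rep (chinese_monoid n) scale \<rho>"
proof -
  interpret monoid_representation "chinese_monoid n" scale \<rho>
    by (rule assms(3))
  interpret ops: uncountable_closed_vector_space scale
    using assms(1) by unfold_locales
  define cls where "cls = (\<lambda>w. presentation_cong {1..n} (chinese_relations n) `` {w})"
  have carrier: "carrier (chinese_monoid n) = cls ` lists {1..n}"
    by (auto simp: chinese_monoid_def presented_monoid_def cls_def quotient_def)
  have rep_append: "\<rho> (cls (u @ v)) x = \<rho> (cls u) (\<rho> (cls v) x)"
    if "u \<in> lists {1..n}" "v \<in> lists {1..n}" for u v x
    using rep_mult[of "cls u" "cls v"] that chinese_monoid_mult_class[OF that]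
    by (simp add: carrier cls_def)
  have rep_empty: "\<rho> (cls []) x = x" for x
    using rep_one by (simp add: cls_def chinese_monoid_def presented_monoid_def)
  define a where "a = (\<lambda>i. \<rho> (cls [i]))"
  have rep_Cons: "\<rho> (cls (i # w)) x = a i (\<rho> (cls w) x)" if "i \<in> {1..n}" "w \<in> lists {1..n}" for i w x
    using rep_append[of "[i]" w x] that by (simp add: a_def)
  have three: "\<rho> (cls [i, j, l]) x = a i (a j (a l x))" if "i \<in> {1..n}" "j \<in> {1..n}" "l \<in> {1..n}" for i j l x
    using that by (simp add: rep_Cons rep_empty)
  have "ops.chinese_on {1..n} a UNIV"
    unfolding ops.chinese_on_def
  proof (intro ballI impI)
    fix i j l and v :: 'v
    assume S: "i \<in> {1..n}" "j \<in> {1..n}" "l \<in> {1..n}" and le: "i \<le> j" "j \<le> l"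
    have "([j, l, i], [l, j, i]) \<in> chinese_relations n" "([l, j, i], [l, i, j]) \<in> chinese_relations n"
      using S le by (auto simp: chinese_relations_def)
    then have "cls [j, l, i] = cls [l, j, i]" "cls [l, j, i] = cls [l, i, j]"
      unfolding cls_def using S by (intro chinese_class_eq; simp)+
    then show "a j (a l (a i v)) = a l (a j (a i v)) \<and> a l (a j (a i v)) = a l (a i (a j v))"
      using S by (metis three)
  qed
  moreover have "ops.irreducible_on (a ` {1..n}) UNIV"
    unfolding ops.irreducible_on_def
  proof (intro conjI allI impI)
    show "(UNIV :: 'v set) \<noteq> {0}"
      using assms(4) by (simp add: irreducible_rep_def)
    show "\<forall>f\<in>a ` {1..n}. ops.endo f \<and> f ` UNIV \<subseteq> UNIV"
      using rep_linear by (auto simp: a_def carrier)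
    fix W assume W: "subspace W \<and> W \<subseteq> UNIV \<and> (\<forall>f\<in>a ` {1..n}. f ` W \<subseteq> W)"
    have "\<rho> (cls w) x \<in> W" if "w \<in> lists {1..n}" "x \<in> W" for w x
      using that(1)
    proof (induction w)
      case (Cons i w)
      then have "a i (\<rho> (cls w) x) \<in> W" using W by blast
      then show ?case using rep_Cons Cons by simp
    qed (use that(2) rep_empty in simp)
    then have "invariant_subspace W"
      using W by (auto simp: invariant_subspace_def carrier)
    then show "W = {0} \<or> W = UNIV"
      using assms(4) by (simp add: irreducible_rep_def)
  qed (rule subspace_UNIV)
  ultimately have "ops.monomial_on {1..n} a UNIV"
    by (intro ops.chinese_irreducible_monomial) simp_all
  then obtain E where E: "independent E" "span E = UNIV"
    and mon: "\<And>i e. i \<in> {1..n} \<Longrightarrow> e \<in> E \<Longrightarrow> \<exists>c. \<exists>f\<in>E. a i e = scale c f"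
    unfolding ops.monomial_on_def by blast
  have "\<exists>c. \<exists>f\<in>E. \<rho> (cls w) e = scale c f" if "w \<in> lists {1..n}" "e \<in> E" for w e
    using that(1)
  proof (induction w)
    case Nil
    then show ?case
      using that(2) rep_empty scale_one by metis
  next
    case (Cons i w)
    then obtain c f where f: "f \<in> E" "\<rho> (cls w) e = scale c f"
      by blast
    obtain d g where g: "g \<in> E" "a i f = scale d g"
      using mon[OF Cons(1) f(1)] by blast
    have "ops.endo (a i)"
      using rep_linear Cons(1) by (simp add: a_def carrier)
    then have "\<rho> (cls (i # w)) e = scale (c * d) g"
      using rep_Cons Cons f g by (simp add: ops.endo_scale)
    then show ?case using g by blast
  qed
  then have "\<forall>w\<in>carrier (chinese_monoid n). \<forall>e\<in>E. \<exists>c. \<exists>f\<in>E. \<rho> w e = scale c f"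
    by (auto simp: carrier)
  then show ?thesis
    unfolding monomial_rep_def using E by blast
qed

end
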